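(* The positive zeros of the function $z\mapsto J_{\nu}(z)I_{\nu}'(z)-J_{\nu}'(z)I_{\nu}(z)$ increase with $\nu$ on $(-1,\infty)$; that is, for each $n\in\mathbb{N}$, if $\gamma_{\nu,n}$ denotes the $n$th positive zero of this function, then $\nu\mapsto\gamma_{\nu,n}$ is increasing on $(-1,\infty)$.
   Context: $J_\nu$ and $I_\nu$ are the Bessel and modified Bessel functions of the first kind of order $\nu$, and primes denote differentiation with respect to $z$. Positive zeros are listed in increasing order, and $\mathbb{N}=\{1,2,3,\dots\}$. *)

theory Defs
  imports "HOL-Analysis.Analysis"
begin

text \<open>
  Bessel functions of the first kind of real order, given by their defining power series. The
  factor \<^term>\<open>(z / 2) powr \<nu>\<close> is the usual real power only for positive \<open>z\<close>, so both functions are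
  meaningful only there. The reciprocal gamma function \<^const>\<open>rGamma\<close> vanishes at the poles of
  \<^const>\<open>Gamma\<close>, which is the usual convention for negative integer orders.
\<close>

definition bessel_J :: "real \<Rightarrow> real \<Rightarrow> real" where
  "bessel_J \<nu> z =
     (z / 2) powr \<nu> * (\<Sum>k. (- 1) ^ k * rGamma (\<nu> + real k + 1) / fact k * (z / 2) ^ (2 * k))"

definition bessel_I :: "real \<Rightarrow> real \<Rightarrow> real" where
  "bessel_I \<nu> z =
     (z / 2) powr \<nu> * (\<Sum>k. rGamma (\<nu> + real k + 1) / fact k * (z / 2) ^ (2 * k))"

definition bessel_cross :: "real \<Rightarrow> real \<Rightarrow> real" where
  "bessel_cross \<nu> z =
     bessel_J \<nu> z * deriv (bessel_I \<nu>) z - deriv (bessel_J \<nu>) z * bessel_I \<nu> z"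

text \<open>
  \<open>z\<close> is the \<open>n\<close>th positive zero of \<open>f\<close>, counted from 1: it is a positive zero, and exactly \<open>n\<close>
  positive zeros are at most \<open>z\<close>. Finiteness is required because \<^const>\<open>card\<close> is 0 on infinite
  sets. Zeros are listed as distinct points, without multiplicity.
\<close>

definition is_nth_pos_zero :: "(real \<Rightarrow> real) \<Rightarrow> nat \<Rightarrow> real \<Rightarrow> bool" where
  "is_nth_pos_zero f n z \<longleftrightarrow>
     0 < z \<and> f z = 0 \<and> finite {w. 0 < w \<and> w \<le> z \<and> f w = 0} \<and>
     card {w. 0 < w \<and> w \<le> z \<and> f w = 0} = n"

definition nth_pos_zero :: "(real \<Rightarrow> real) \<Rightarrow> nat \<Rightarrow> real" where
  "nth_pos_zero f n = (THE z. is_nth_pos_zero f n z)"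

lemma is_nth_pos_zero_unique:
  assumes "is_nth_pos_zero f n y" "is_nth_pos_zero f n z"
  shows "y = z"
proof -
  have less: False if ab: "is_nth_pos_zero f n a" "is_nth_pos_zero f n b" "a < b" for a b
  proof -
    define A where "A = {w. 0 < w \<and> w \<le> a \<and> f w = 0}"
    define B where "B = {w. 0 < w \<and> w \<le> b \<and> f w = 0}"
    have "A \<subseteq> B" using ab(3) by (auto simp: A_def B_def)
    moreover have "b \<in> B" "b \<notin> A" "finite B" "card A = n" "card B = n"
      using ab by (simp_all add: A_def B_def is_nth_pos_zero_def)
    ultimately show False
      using card_subset_eq[of B A] by simp
  qed
  show ?thesis
    by (cases y z rule: linorder_cases) (use less assms in blast)+
qed

lemma nth_pos_zero_eq: "is_nth_pos_zero f n z \<Longrightarrow> nth_pos_zero f n = z"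
  unfolding nth_pos_zero_def by (rule the_equality) (auto intro: is_nth_pos_zero_unique)

end

theory Submission
  imports Defs
begin

text \<open>
  Write \<open>E\<^sub>\<nu>(x) = \<Sum>\<^sub>k x\<^sup>k / (k! \<Gamma>(\<nu> + k + 1))\<close> for the Bessel-Clifford function. With \<open>s = (z / 2)\<^sup>2\<close>,
  \<open>J\<^sub>\<nu>\<close> and \<open>I\<^sub>\<nu>\<close> are \<open>(z / 2)\<^sup>\<nu>\<close> times \<open>A\<^sub>\<nu>(s) = E\<^sub>\<nu>(-s)\<close> and \<open>B\<^sub>\<nu>(s) = E\<^sub>\<nu>(s)\<close>, and the Bessel cross
  product is a positive multiple of \<open>K\<^sub>\<nu> = A\<^sub>\<nu> B\<^sub>\<nu>\<^sub>+\<^sub>1 + A\<^sub>\<nu>\<^sub>+\<^sub>1 B\<^sub>\<nu>\<close>. So everything is about the positive zeros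
  of \<open>K\<^sub>\<nu>\<close>, a function that is jointly continuous in \<open>\<nu> > -1\<close> and \<open>s\<close>, and positive at \<open>s = 0\<close>.

  \<^emph>\<open>In the argument the zeros are simple.\<close> Since \<open>(s\<^sup>\<nu>\<^sup>+\<^sup>1 K\<^sub>\<nu>)' = 2 s\<^sup>\<nu> A\<^sub>\<nu> B\<^sub>\<nu>\<close> and \<open>B\<^sub>\<nu> > 0\<close>, the function
  \<open>s\<^sup>\<nu>\<^sup>+\<^sup>1 K\<^sub>\<nu>\<close> is strictly monotone, in the direction given by the sign of \<open>A\<^sub>\<nu>\<close>, wherever \<open>A\<^sub>\<nu>\<close> does not
  vanish; and \<open>A\<^sub>\<nu>\<close> does not vanish at a zero of \<open>K\<^sub>\<nu>\<close>, because \<open>A\<^sub>\<nu>\<close> and \<open>A\<^sub>\<nu>\<^sub>+\<^sub>1\<close> have no common zero.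

  \<^emph>\<open>In the order the zeros move to the right.\<close> The ratios \<open>A\<^sub>\<nu>\<^sub>+\<^sub>1 / A\<^sub>\<nu>\<close> and \<open>B\<^sub>\<nu>\<^sub>+\<^sub>1 / B\<^sub>\<nu>\<close> decrease with \<open>\<nu>\<close>
  (the first one locally, away from the zeros of \<open>A\<^sub>\<nu>\<close>), which is a statement about the sign of the
  Casoratian \<open>E\<^sub>\<nu> E\<^sub>\<mu>\<^sub>+\<^sub>1 - E\<^sub>\<nu>\<^sub>+\<^sub>1 E\<^sub>\<mu>\<close>. For \<open>B\<close> it follows from a first-order differential equation for
  the Casoratian (\<open>casorati_deriv\<close>); for \<open>A\<close> the three-term recurrence turns the Casoratian into \<open>-(\<mu> - \<nu>)\<close>
  times a sum that at \<open>\<mu> = \<nu>\<close> is the sum of squares \<open>\<Sum>\<^sub>k s\<^sup>k A\<^sub>\<nu>\<^sub>+\<^sub>k\<^sub>+\<^sub>1\<^sup>2\<close>, up to a remainder of large order,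
  to which the first argument applies (\<open>casorati_neg_argument_sign\<close>). Therefore, at a zero of \<open>K\<^sub>\<nu>\<close>, the
  value of \<open>K\<^sub>\<mu>\<close> for \<open>\<mu>\<close> slightly above \<open>\<nu>\<close> has the sign opposite to \<open>A\<^sub>\<nu>\<close>, that is, the sign that
  \<open>K\<^sub>\<nu>\<close> has just before its zero; for \<open>\<mu>\<close> slightly below \<open>\<nu>\<close> it has the sign of \<open>A\<^sub>\<nu>\<close>.

  \<^emph>\<open>Counting.\<close> Let \<open>\<gamma>\<close> be the \<open>n\<close>th zero of \<open>K\<^sub>\<nu>\<close>. By compactness of \<open>[0, \<gamma>]\<close>, for \<open>\<mu>\<close> slightly above
  \<open>\<nu>\<close> no zeros of \<open>K\<^sub>\<mu>\<close> appear in \<open>[0, \<gamma>]\<close> except at most one near each of the first \<open>n - 1\<close> zeros, so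
  the \<open>n\<close>th zero of \<open>K\<^sub>\<mu>\<close> is larger than \<open>\<gamma>\<close>; for \<open>\<mu>\<close> slightly below \<open>\<nu>\<close> each of the \<open>n\<close> zeros reappears
  further to the left. So the \<open>n\<close>th zero is strictly increasing locally, hence globally.

  \<^emph>\<open>There are infinitely many zeros.\<close> The Riccati equation of \<open>p = J\<^sub>\<nu>\<^sub>+\<^sub>1 / J\<^sub>\<nu>\<close> makes \<open>arctan p\<close> grow
  at a rate of at least \<open>1/2\<close>, so \<open>J\<^sub>\<nu>\<close> keeps vanishing, and \<open>K\<^sub>\<nu>\<close> vanishes between two zeros of \<open>J\<^sub>\<nu>\<close> by
  Rolle's theorem for \<open>A\<^sub>\<nu> / B\<^sub>\<nu>\<close>.
\<close>

section \<open>The Bessel-Clifford function\<close>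

definition clifford :: "real \<Rightarrow> real \<Rightarrow> real" where
  "clifford \<nu> x = (\<Sum>k. rGamma (\<nu> + real k + 1) / fact k * x ^ k)"

lemma rGamma_step:
  "rGamma (\<nu> + real k + 1) = (\<nu> + real k + 1) * rGamma (\<nu> + real (Suc k) + 1 :: real)"
  using rGamma_plus1[of "\<nu> + real k + 1"] by (simp add: add_ac)

text \<open>
  A bound that is uniform in the order and in the index of the coefficient: it is what makes the power
  series converge uniformly in both variables. From \<open>x \<ge> 1\<close> on, each step \<open>x \<mapsto> x + 1\<close> divides the reciprocal
  gamma function by \<open>x\<close>, so a bound on a compact interval suffices.
\<close>
lemma rGamma_shift_bounded:
  fixes R :: real
  shows "\<exists>M. \<forall>\<nu>\<in>{-1..R}. \<forall>k. \<bar>rGamma (\<nu> + real k + 1)\<bar> \<le> M"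
proof -
  have "compact (rGamma ` {0..R + 3})"
    by (intro compact_continuous_image continuous_intros) auto
  then obtain M where M: "\<And>x. x \<in> {0..R + 3} \<Longrightarrow> \<bar>rGamma x\<bar> \<le> M"
    by (metis bounded_iff compact_imp_bounded imageI real_norm_def)
  have "\<bar>rGamma (\<nu> + real k + 1)\<bar> \<le> M" if "\<nu> \<in> {-1..R}" for \<nu> k
  proof (induction k)
    case 0
    then show ?case using that by (intro M) auto
  next
    case (Suc k)
    show ?case
    proof (cases "\<nu> + real k + 1 \<ge> 1")
      case True
      have "\<bar>rGamma (\<nu> + real (Suc k) + 1)\<bar> = \<bar>rGamma (\<nu> + real k + 1)\<bar> / (\<nu> + real k + 1)"
        unfolding rGamma_step[of \<nu> k] using True by (simp add: abs_mult)
      also have "\<dots> \<le> \<bar>rGamma (\<nu> + real k + 1)\<bar>"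
        using True by (simp add: divide_le_eq mult_le_cancel_left1)
      finally show ?thesis using Suc by simp
    next
      case False
      then show ?thesis using that by (intro M) auto
    qed
  qed
  then show ?thesis by blast
qed

lemma summable_clifford:
  assumes "\<nu> > -1"
  shows "summable (\<lambda>k. rGamma (\<nu> + real k + 1) / fact k * x ^ k)"
proof -
  obtain M where M: "\<And>k. \<bar>rGamma (\<nu> + real k + 1)\<bar> \<le> M"
    using rGamma_shift_bounded[of \<nu>] assms by force
  show ?thesis
  proof (rule summable_comparison_test')
    show "summable (\<lambda>k. M * (inverse (fact k) * \<bar>x\<bar> ^ k))"
      by (intro summable_mult summable_exp)
    show "norm (rGamma (\<nu> + real k + 1) / fact k * x ^ k) \<le> M * (inverse (fact k) * \<bar>x\<bar> ^ k)"
      for k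
      using mult_right_mono[OF M[of k], of "inverse (fact k) * \<bar>x\<bar> ^ k"]
      by (simp add: abs_mult power_abs divide_inverse mult.assoc)
  qed
qed

lemma rGamma_real_pos: "x > 0 \<Longrightarrow> rGamma (x :: real) > 0"
  using Gamma_real_pos[of x] by (simp add: rGamma_inverse_Gamma)

lemma clifford_pos:
  assumes "\<nu> > -1" "x \<ge> 0"
  shows "clifford \<nu> x > 0"
  unfolding clifford_def
proof (rule suminf_pos2[OF summable_clifford[OF assms(1)], of _ 0])
  show "0 \<le> rGamma (\<nu> + real k + 1) / fact k * x ^ k" for k
    using assms rGamma_real_pos[of "\<nu> + real k + 1"] by simp
  show "0 < rGamma (\<nu> + real 0 + 1) / fact 0 * x ^ 0"
    using assms rGamma_real_pos[of "\<nu> + 1"] by simp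
qed

lemma clifford_deriv [derivative_intros]:
  assumes "\<nu> > -1" "(g has_real_derivative d) (at x within S)"
  shows "((\<lambda>x. clifford \<nu> (g x)) has_real_derivative clifford (\<nu> + 1) (g x) * d) (at x within S)"
proof (rule DERIV_chain2[OF _ assms(2)])
  have "diffs (\<lambda>k. rGamma (\<nu> + real k + 1) / fact k) = (\<lambda>k. rGamma (\<nu> + 1 + real k + 1) / fact k)"
    by (auto simp: diffs_def fun_eq_iff field_simps simp del: of_nat_Suc) (simp add: add_ac)
  then show "(clifford \<nu> has_real_derivative clifford (\<nu> + 1) (g x)) (at (g x))"
    using termdiffs_strong_converges_everywhere[OF summable_clifford[OF assms(1)], of "g x"]
    unfolding clifford_def[abs_def] by simp
qed

text \<open>
  The three-term recurrence of the Bessel functions; as differentiation raises the order by one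
  (\<open>clifford_deriv\<close>), it is also the Bessel differential equation. It comes from \<open>\<Gamma>(x + 1) = x \<Gamma>(x)\<close> with
  \<open>x = \<nu> + k + 1\<close>: the part \<open>\<nu> + 1\<close> of the factor gives the first term, the part \<open>k\<close> the second.
\<close>
lemma clifford_recurrence:
  assumes "\<nu> > -1"
  shows "clifford \<nu> x = (\<nu> + 1) * clifford (\<nu> + 1) x + x * clifford (\<nu> + 1 + 1) x"
proof -
  have S: "(\<lambda>k. rGamma (\<kappa> + real k + 1) / fact k * x ^ k) sums clifford \<kappa> x" if "\<kappa> > -1" for \<kappa>
    using summable_clifford[OF that] by (simp add: clifford_def summable_sums)
  define h where "h k = real k * (rGamma (\<nu> + 1 + real k + 1) / fact k * x ^ k)" for k
  have "(\<lambda>k. h (Suc k)) sums (x * clifford (\<nu> + 1 + 1) x)"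
  proof -
    have "h (Suc k) = x * (rGamma (\<nu> + 1 + 1 + real k + 1) / fact k * x ^ k)" for k
      unfolding h_def by (simp add: field_simps del: of_nat_Suc) (simp add: add_ac)
    then show ?thesis using sums_mult[OF S[of "\<nu> + 1 + 1"], of x] assms by simp
  qed
  then have "h sums (x * clifford (\<nu> + 1 + 1) x)"
    using sums_Suc_iff[of h] by (simp add: h_def)
  from sums_add[OF sums_mult[OF S[of "\<nu> + 1"], of "\<nu> + 1"] this]
  have "(\<lambda>k. (\<nu> + 1) * (rGamma (\<nu> + 1 + real k + 1) / fact k * x ^ k) + h k) sums
        ((\<nu> + 1) * clifford (\<nu> + 1) x + x * clifford (\<nu> + 1 + 1) x)"
    using assms by simp
  moreover have "(\<nu> + 1) * (rGamma (\<nu> + 1 + real k + 1) / fact k * x ^ k) + h k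
                 = rGamma (\<nu> + real k + 1) / fact k * x ^ k" for k
    unfolding rGamma_step[of \<nu> k] h_def by (simp add: algebra_simps add_divide_distrib)
  ultimately show ?thesis using sums_unique2[OF _ S[OF assms]] by simp
qed

lemma clifford_continuous:
  assumes "\<nu> > -1"
  shows "isCont (\<lambda>p. clifford (fst p) (snd p)) (\<nu>, x)"
proof -
  define R where "R = \<bar>\<nu>\<bar> + \<bar>x\<bar> + 1"
  define U where "U = {-1<..<R} \<times> {-R<..<R}"
  obtain M where M: "\<And>\<nu> k. \<nu> \<in> {-1..R} \<Longrightarrow> \<bar>rGamma (\<nu> + real k + 1)\<bar> \<le> M"
    using rGamma_shift_bounded[of R] by blast
  have "uniform_limit U (\<lambda>n p. \<Sum>k<n. rGamma (fst p + real k + 1) / fact k * snd p ^ k)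
          (\<lambda>p. \<Sum>k. rGamma (fst p + real k + 1) / fact k * snd p ^ k) sequentially"
  proof (rule Weierstrass_m_test)
    show "summable (\<lambda>k. M * (inverse (fact k) * R ^ k))"
      by (intro summable_mult summable_exp)
    show "norm (rGamma (fst p + real k + 1) / fact k * snd p ^ k) \<le> M * (inverse (fact k) * R ^ k)"
      if "p \<in> U" for k p
    proof -
      have "\<bar>snd p\<bar> ^ k \<le> R ^ k"
        using that by (intro power_mono) (auto simp: U_def)
      moreover have "\<bar>rGamma (fst p + real k + 1)\<bar> \<le> M"
        using that by (intro M) (auto simp: U_def)
      ultimately have "\<bar>rGamma (fst p + real k + 1)\<bar> * (inverse (fact k) * \<bar>snd p\<bar> ^ k)
                         \<le> M * (inverse (fact k) * R ^ k)"
        by (intro mult_mono) auto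
      then show ?thesis by (simp add: abs_mult power_abs divide_inverse mult.assoc)
    qed
  qed
  then have "continuous_on U (\<lambda>p. \<Sum>k. rGamma (fst p + real k + 1) / fact k * snd p ^ k)"
    by (rule uniform_limit_theorem[rotated])
       (auto intro!: always_eventually continuous_intros
          continuous_on_compose2[OF continuous_on_rGamma[of UNIV]])
  moreover have "open U" "(\<nu>, x) \<in> U"
    using assms by (auto simp: U_def R_def intro!: open_Times)
  ultimately show ?thesis
    by (simp add: clifford_def continuous_on_eq_continuous_at)
qed

lemma tendsto_clifford [tendsto_intros]:
  assumes "(f \<longlongrightarrow> \<nu>) F" "(g \<longlongrightarrow> x) F" "\<nu> > -1"
  shows "((\<lambda>t. clifford (f t) (g t)) \<longlongrightarrow> clifford \<nu> x) F"
  using isCont_tendsto_compose[OF clifford_continuous[OF assms(3)] tendsto_Pair[OF assms(1,2)]]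
  by simp

text \<open>
  For \<open>t < \<nu> + 1\<close> the terms of the alternating series decrease, so it exceeds the difference of the first
  two terms.
\<close>
lemma clifford_neg_pos:
  assumes "\<nu> > -1" "0 \<le> t" "t < \<nu> + 1"
  shows "clifford \<nu> (- t) > 0"
proof -
  define a where "a k = rGamma (\<nu> + real k + 1) / fact k * t ^ k" for k
  have rec: "a (Suc k) = a k * (t / ((\<nu> + real k + 1) * (real k + 1)))" for k
  proof -
    have "\<nu> + real k + 1 \<noteq> 0" using assms by simp
    then show ?thesis
      unfolding a_def rGamma_step[of \<nu> k] by (simp add: divide_simps)
  qed
  have pos: "a k \<ge> 0" for k
    using assms rGamma_real_pos[of "\<nu> + real k + 1"] by (simp add: a_def)
  have mono: "a (Suc k) \<le> a k" for k
  proof -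
    have "t \<le> (\<nu> + real k + 1) * 1" using assms by simp
    also have "\<dots> \<le> (\<nu> + real k + 1) * (real k + 1)"
      using assms by (intro mult_left_mono) auto
    finally have "t / ((\<nu> + real k + 1) * (real k + 1)) \<le> 1"
      using assms by (simp add: divide_le_eq_1)
    then show ?thesis unfolding rec using pos[of k] assms by (intro mult_right_le_one_le) auto
  qed
  have "summable a" unfolding a_def by (rule summable_clifford[OF assms(1)])
  then have "a \<longlonglongrightarrow> 0" by (rule summable_LIMSEQ_zero)
  from summable_Leibniz'(2)[OF this pos mono, of 1]
  have "a 0 - a 1 \<le> (\<Sum>i. (-1) ^ i * a i)"
    by (simp add: numeral_2_eq_2)
  also have "\<dots> = clifford \<nu> (- t)"
    unfolding clifford_def a_def by (simp add: power_minus[of t] mult_ac)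
  finally have "a 0 - a 1 \<le> clifford \<nu> (- t)" .
  moreover have "a 1 < a 0"
  proof -
    have "a 1 = a 0 * (t / (\<nu> + 1))" using rec[of 0] by simp
    also have "\<dots> < a 0 * 1"
      using rGamma_real_pos[of "\<nu> + 1"] assms by (intro mult_strict_left_mono) (auto simp: a_def)
    finally show ?thesis by simp
  qed
  ultimately show ?thesis by simp
qed

text \<open>
  By the recurrence a common zero would be shared by all \<open>\<nu> + k\<close>, but for large order the function is
  positive there.
\<close>
lemma clifford_no_common_zero:
  assumes "\<nu> > -1" "s > 0" "clifford \<nu> (- s) = 0"
  shows "clifford (\<nu> + 1) (- s) \<noteq> 0"
proof
  assume *: "clifford (\<nu> + 1) (- s) = 0"
  have "clifford (\<nu> + real k) (- s) = 0 \<and> clifford (\<nu> + real k + 1) (- s) = 0" for k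
  proof (induction k)
    case (Suc k)
    moreover have "clifford (\<nu> + real k) (- s) =
        (\<nu> + real k + 1) * clifford (\<nu> + real k + 1) (- s) + - s * clifford (\<nu> + real k + 1 + 1) (- s)"
      using assms by (intro clifford_recurrence) auto
    ultimately have "clifford (\<nu> + real k + 1 + 1) (- s) = 0"
      using assms by (metis add_0 less_irrefl mult_eq_0_iff mult_zero_right neg_equal_0_iff_equal)
    then show ?case using Suc by (simp add: add_ac)
  qed (use assms * in auto)
  moreover obtain k where "real k > s" using reals_Archimedean2 by blast
  ultimately show False using clifford_neg_pos[of "\<nu> + real k" s] assms by simp
qed

section \<open>The Casoratian of two orders\<close>

text \<open>
  Its sign compares the ratios \<open>E\<^sub>\<nu>\<^sub>+\<^sub>1 / E\<^sub>\<nu>\<close> and \<open>E\<^sub>\<mu>\<^sub>+\<^sub>1 / E\<^sub>\<mu>\<close>.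
\<close>
definition casorati :: "real \<Rightarrow> real \<Rightarrow> real \<Rightarrow> real" where
  "casorati \<nu> \<mu> x = clifford \<nu> x * clifford (\<mu> + 1) x - clifford (\<nu> + 1) x * clifford \<mu> x"

text \<open>
  The scaling \<open>c\<close> allows \<open>c = 1\<close> (modified Bessel functions) and \<open>c = -1\<close> (Bessel functions) to be
  treated at once. The weight \<open>t\<^sup>\<mu>\<^sup>+\<^sup>1\<close> is the integrating factor that leaves only a product of
  two functions on the right.
\<close>
lemma casorati_deriv:
  assumes "\<nu> > -1" "\<mu> > -1" "t > 0"
  shows "((\<lambda>t. t powr (\<mu> + 1) * casorati \<nu> \<mu> (c * t)) has_real_derivative
           - (\<mu> - \<nu>) * t powr \<mu> * (clifford (\<nu> + 1) (c * t) * clifford \<mu> (c * t))) (at t)"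
proof -
  let ?E = "\<lambda>\<kappa>. clifford \<kappa> (c * t)"
  have "((\<lambda>t. t powr (\<mu> + 1) * casorati \<nu> \<mu> (c * t)) has_real_derivative
          (\<mu> + 1) * t powr \<mu> * casorati \<nu> \<mu> (c * t) +
          t powr (\<mu> + 1) * (c * (?E \<nu> * ?E (\<mu> + 1 + 1) - ?E (\<nu> + 1 + 1) * ?E \<mu>))) (at t)"
    unfolding casorati_def using assms
    by (auto intro!: derivative_eq_intros simp: algebra_simps)
  moreover have "t powr (\<mu> + 1) = t powr \<mu> * t" using assms by (simp add: powr_add)
  moreover have "c * t * ?E (\<nu> + 1 + 1) = ?E \<nu> - (\<nu> + 1) * ?E (\<nu> + 1)"
                "c * t * ?E (\<mu> + 1 + 1) = ?E \<mu> - (\<mu> + 1) * ?E (\<mu> + 1)"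
    using clifford_recurrence[of \<nu> "c * t"] clifford_recurrence[of \<mu> "c * t"] assms by auto
  then have "t * (c * (?E \<nu> * ?E (\<mu> + 1 + 1) - ?E (\<nu> + 1 + 1) * ?E \<mu>)) =
      - (\<mu> + 1) * casorati \<nu> \<mu> (c * t) - (\<mu> - \<nu>) * (?E (\<nu> + 1) * ?E \<mu>)"
    unfolding casorati_def by algebra
  ultimately have "((\<lambda>t. t powr (\<mu> + 1) * casorati \<nu> \<mu> (c * t)) has_real_derivative
      (\<mu> + 1) * t powr \<mu> * casorati \<nu> \<mu> (c * t) +
      t powr \<mu> * (- (\<mu> + 1) * casorati \<nu> \<mu> (c * t) - (\<mu> - \<nu>) * (?E (\<nu> + 1) * ?E \<mu>))) (at t)"
    by (simp add: mult.assoc)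
  then show ?thesis by (rule DERIV_cong) (simp add: algebra_simps)
qed

text \<open>
  The weighted Casoratian vanishes at 0 because \<open>\<mu> + 1 > 0\<close>, and it decreases from there.
\<close>
lemma casorati_neg:
  assumes "\<nu> > -1" "\<nu> < \<mu>" "s > 0"
    and pos: "\<And>t. 0 < t \<Longrightarrow> t < s \<Longrightarrow> clifford (\<nu> + 1) (c * t) * clifford \<mu> (c * t) > 0"
  shows "casorati \<nu> \<mu> (c * s) < 0"
proof -
  let ?f = "\<lambda>t. t powr (\<mu> + 1) * casorati \<nu> \<mu> (c * t)"
  have "?f s < ?f 0"
  proof (rule DERIV_neg_imp_decreasing_open[OF \<open>s > 0\<close>])
    show "\<exists>y. DERIV ?f t :> y \<and> y < 0" if "0 < t" "t < s" for t
    proof (intro exI conjI)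
      show "DERIV ?f t :> - (\<mu> - \<nu>) * t powr \<mu> * (clifford (\<nu> + 1) (c * t) * clifford \<mu> (c * t))"
        using assms that by (intro casorati_deriv) auto
      show "- (\<mu> - \<nu>) * t powr \<mu> * (clifford (\<nu> + 1) (c * t) * clifford \<mu> (c * t)) < 0"
        using pos[OF that] assms that by (intro mult_neg_pos) auto
    qed
    have "continuous_on {0..s} (\<lambda>t. casorati \<nu> \<mu> (c * t))"
      unfolding casorati_def using assms
      by (intro DERIV_atLeastAtMost_imp_continuous_on) (auto intro!: derivative_eq_intros exI)
    moreover have "continuous_on {0..s} (\<lambda>t. t powr (\<mu> + 1))"
      using assms by (intro continuous_on_powr') (auto intro!: continuous_intros)
    ultimately show "continuous_on {0..s} ?f" by (intro continuous_on_mult)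
  qed
  then show ?thesis using assms by (simp add: mult_less_0_iff)
qed

lemma casorati_sign:
  assumes "\<nu> > -1" "\<mu> > -1" "\<nu> \<noteq> \<mu>" "s > 0"
    and pos: "\<And>\<kappa> t. min \<nu> \<mu> \<le> \<kappa> \<Longrightarrow> 0 < t \<Longrightarrow> t < s \<Longrightarrow> clifford \<kappa> (c * t) > 0"
  shows "(\<mu> - \<nu>) * casorati \<nu> \<mu> (c * s) < 0"
proof (cases "\<nu> < \<mu>")
  case True
  then have "casorati \<nu> \<mu> (c * s) < 0" using assms by (intro casorati_neg) auto
  then show ?thesis using True by (simp add: mult_less_0_iff)
next
  case False
  then have "casorati \<mu> \<nu> (c * s) < 0" using assms by (intro casorati_neg) auto
  moreover have "casorati \<mu> \<nu> (c * s) = - casorati \<nu> \<mu> (c * s)" by (simp add: casorati_def)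
  ultimately show ?thesis using False assms(3) by (simp add: mult_less_0_iff)
qed

text \<open>
  Iterating the recurrence, which gives \<open>C\<^sub>\<nu>\<^sub>,\<^sub>\<mu> = -(\<mu> - \<nu>) A\<^sub>\<nu>\<^sub>+\<^sub>1 A\<^sub>\<mu>\<^sub>+\<^sub>1 + s C\<^sub>\<nu>\<^sub>+\<^sub>1\<^sub>,\<^sub>\<mu>\<^sub>+\<^sub>1\<close>. Unlike the derivative in
  \<open>casorati_deriv\<close>, the terms become squares as \<open>\<mu> \<rightarrow> \<nu>\<close>, so that their sign is known even where the
  functions \<open>A\<close> oscillate.
\<close>
lemma casorati_expand:
  assumes "\<nu> > -1" "\<mu> > -1"
  shows "casorati \<nu> \<mu> (- s) =
    - (\<mu> - \<nu>) * (\<Sum>k<m. s ^ k * (clifford (\<nu> + real k + 1) (- s) * clifford (\<mu> + real k + 1) (- s)))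
    + s ^ m * casorati (\<nu> + real m) (\<mu> + real m) (- s)"
proof (induction m)
  case (Suc m)
  let ?a = "\<nu> + real m" and ?b = "\<mu> + real m"
  have "casorati ?a ?b (- s) = - (\<mu> - \<nu>) * (clifford (?a + 1) (- s) * clifford (?b + 1) (- s))
          + s * casorati (?a + 1) (?b + 1) (- s)"
  proof -
    have "clifford ?a (- s) = (?a + 1) * clifford (?a + 1) (- s) + - s * clifford (?a + 1 + 1) (- s)"
         "clifford ?b (- s) = (?b + 1) * clifford (?b + 1) (- s) + - s * clifford (?b + 1 + 1) (- s)"
      using assms by (intro clifford_recurrence; simp)+
    then show ?thesis unfolding casorati_def by algebra
  qed
  moreover have "\<nu> + real (Suc m) = ?a + 1" "\<mu> + real (Suc m) = ?b + 1" by auto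
  moreover have "- d * S + p * (- d * x + q * y) = - d * (S + p * x) + q * p * y" for d S p q x y :: real
    by algebra
  ultimately show ?case unfolding Suc.IH sum.lessThan_Suc power_Suc by (simp only:)
qed simp

text \<open>
  The number \<open>m\<close> of terms split off is chosen so large that all functions of order at least \<open>\<nu> + m\<close> are
  positive on \<open>[0, s]\<close>. Then the remainder has the right sign by \<open>casorati_sign\<close>, and the finite sum is
  positive for \<open>\<mu>\<close> near \<open>\<nu>\<close> by continuity, as its limit is a sum of squares.
\<close>
lemma casorati_neg_argument_sign:
  assumes "\<nu> > -1" "s > 0"
  shows "\<forall>\<^sub>F \<mu> in at \<nu>. (\<mu> - \<nu>) * casorati \<nu> \<mu> (- s) < 0"
proof -
  obtain m :: nat where m: "real m > s + 1" using reals_Archimedean2 by blast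
  have pos: "clifford \<kappa> (- t) > 0" if "\<kappa> \<ge> real m - 1" "0 \<le> t" "t \<le> s" for \<kappa> t
    using that m assms by (intro clifford_neg_pos) auto
  define S where
    "S \<mu> = (\<Sum>k<m. s ^ k * (clifford (\<nu> + real k + 1) (- s) * clifford (\<mu> + real k + 1) (- s)))" for \<mu>
  have "S \<nu> > 0"
    unfolding S_def
  proof (rule sum_pos2[of _ "m - 1"])
    show "m - 1 \<in> {..<m}" using m assms by auto
    show "0 < s ^ (m - 1) * (clifford (\<nu> + real (m - 1) + 1) (- s) * clifford (\<nu> + real (m - 1) + 1) (- s))"
      using pos[of "\<nu> + real (m - 1) + 1" s] m assms by (simp add: of_nat_diff)
  qed (use assms in auto)
  moreover have "(S \<longlongrightarrow> S \<nu>) (at \<nu>)"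
    unfolding S_def using assms by (intro tendsto_intros) auto
  ultimately have "\<forall>\<^sub>F \<mu> in at \<nu>. S \<mu> > 0" by (rule order_tendstoD(1)[rotated])
  moreover have "\<forall>\<^sub>F \<mu> in at \<nu>. \<mu> > -1"
    using assms by (intro order_tendstoD(1)[OF tendsto_ident_at]) auto
  moreover have "\<forall>\<^sub>F \<mu> in at \<nu>. \<mu> \<noteq> \<nu>" by (simp add: eventually_at_filter)
  ultimately show ?thesis
  proof eventually_elim
    case (elim \<mu>)
    have "(\<mu> + real m - (\<nu> + real m)) * casorati (\<nu> + real m) (\<mu> + real m) (-1 * s) < 0"
    proof (rule casorati_sign)
      show "clifford \<kappa> (-1 * t) > 0" if "min (\<nu> + real m) (\<mu> + real m) \<le> \<kappa>" "0 < t" "t < s" for \<kappa> t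
        using pos[of \<kappa> t] that assms elim by auto
    qed (use assms elim in auto)
    then have "s ^ m * ((\<mu> - \<nu>) * casorati (\<nu> + real m) (\<mu> + real m) (- s)) < 0"
      using assms by (simp add: mult_less_0_iff)
    moreover have "(\<mu> - \<nu>)\<^sup>2 * S \<mu> > 0" using elim by simp
    moreover have "(\<mu> - \<nu>) * casorati \<nu> \<mu> (- s) =
        - ((\<mu> - \<nu>)\<^sup>2 * S \<mu>) + s ^ m * ((\<mu> - \<nu>) * casorati (\<nu> + real m) (\<mu> + real m) (- s))"
    proof -
      have "casorati \<nu> \<mu> (- s) =
          - (\<mu> - \<nu>) * S \<mu> + s ^ m * casorati (\<nu> + real m) (\<mu> + real m) (- s)"
        unfolding S_def using assms elim by (intro casorati_expand) auto
      moreover have "d * (- d * x + p * y) = - (d\<^sup>2 * x) + p * (d * y)" for d p x y :: real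
        by algebra
      ultimately show ?thesis by (simp only:)
    qed
    ultimately show ?case by linarith
  qed
qed

section \<open>The cross product and the motion of its zeros\<close>

definition clifford_cross :: "real \<Rightarrow> real \<Rightarrow> real" where
  "clifford_cross \<nu> s = clifford \<nu> (- s) * clifford (\<nu> + 1) s + clifford (\<nu> + 1) (- s) * clifford \<nu> s"

lemma tendsto_clifford_cross [tendsto_intros]:
  assumes "(f \<longlongrightarrow> \<nu>) F" "(g \<longlongrightarrow> s) F" "\<nu> > -1"
  shows "((\<lambda>t. clifford_cross (f t) (g t)) \<longlongrightarrow> clifford_cross \<nu> s) F"
  unfolding clifford_cross_def using assms by (intro tendsto_intros) auto

lemma continuous_on_clifford_cross:
  assumes "\<nu> > -1"
  shows "continuous_on X (clifford_cross \<nu>)"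
  unfolding continuous_on_def using assms by (auto intro!: tendsto_intros)

text \<open>
  In terms of Bessel functions: \<open>z (J I' - J' I)\<close> has the derivative \<open>2 z J I\<close>.
\<close>
lemma clifford_cross_deriv:
  assumes "\<nu> > -1" "s > 0"
  shows "((\<lambda>s. s powr (\<nu> + 1) * clifford_cross \<nu> s) has_real_derivative
           2 * s powr \<nu> * (clifford \<nu> (- s) * clifford \<nu> s)) (at s)"
proof -
  let ?A = "\<lambda>\<kappa>. clifford \<kappa> (- s)" and ?B = "\<lambda>\<kappa>. clifford \<kappa> s"
  have "((\<lambda>s. s powr (\<nu> + 1) * clifford_cross \<nu> s) has_real_derivative
      (\<nu> + 1) * s powr \<nu> * clifford_cross \<nu> s +
      s powr (\<nu> + 1) * (?A \<nu> * ?B (\<nu> + 1 + 1) - ?A (\<nu> + 1 + 1) * ?B \<nu>)) (at s)"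
    unfolding clifford_cross_def using assms
    by (auto intro!: derivative_eq_intros simp: algebra_simps)
  moreover have "s powr (\<nu> + 1) = s powr \<nu> * s" using assms by (simp add: powr_add)
  moreover have "?B \<nu> = (\<nu> + 1) * ?B (\<nu> + 1) + s * ?B (\<nu> + 1 + 1)"
                "?A \<nu> = (\<nu> + 1) * ?A (\<nu> + 1) + - s * ?A (\<nu> + 1 + 1)"
    using assms by (intro clifford_recurrence; simp)+
  then have "s * (?A \<nu> * ?B (\<nu> + 1 + 1) - ?A (\<nu> + 1 + 1) * ?B \<nu>) =
      2 * (?A \<nu> * ?B \<nu>) - (\<nu> + 1) * clifford_cross \<nu> s"
    unfolding clifford_cross_def by algebra
  ultimately have "((\<lambda>s. s powr (\<nu> + 1) * clifford_cross \<nu> s) has_real_derivative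
      (\<nu> + 1) * s powr \<nu> * clifford_cross \<nu> s +
      s powr \<nu> * (2 * (?A \<nu> * ?B \<nu>) - (\<nu> + 1) * clifford_cross \<nu> s)) (at s)"
    by (simp add: mult.assoc)
  then show ?thesis by (rule DERIV_cong) (simp add: algebra_simps)
qed

lemma clifford_cross_at_0: "\<nu> > -1 \<Longrightarrow> clifford_cross \<nu> 0 > 0"
  using clifford_pos[of \<nu> 0] clifford_pos[of "\<nu> + 1" 0] by (simp add: clifford_cross_def)

lemma clifford_cross_zero_imp:
  assumes "\<nu> > -1" "s > 0" "clifford_cross \<nu> s = 0"
  shows "clifford \<nu> (- s) \<noteq> 0"
  using clifford_no_common_zero[of \<nu> s] clifford_pos[of \<nu> s] assms
  by (auto simp: clifford_cross_def)

text \<open>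
  The constant \<open>c\<close> only carries the sign of \<open>A\<^sub>\<nu>\<close>, so that both signs are covered by one statement; it
  will be the value of \<open>A\<close> at the zero under consideration.
\<close>
lemma clifford_cross_increasing:
  assumes "\<nu> > -1" "0 < s" "s < t"
    and pos: "\<And>x. s \<le> x \<Longrightarrow> x \<le> t \<Longrightarrow> c * clifford \<nu> (- x) > 0"
  shows "s powr (\<nu> + 1) * (c * clifford_cross \<nu> s) < t powr (\<nu> + 1) * (c * clifford_cross \<nu> t)"
proof -
  have "c * (s powr (\<nu> + 1) * clifford_cross \<nu> s) < c * (t powr (\<nu> + 1) * clifford_cross \<nu> t)"
  proof (rule DERIV_pos_imp_increasing[OF \<open>s < t\<close>], intro exI conjI)
    fix x assume x: "s \<le> x" "x \<le> t"
    show "((\<lambda>x. c * (x powr (\<nu> + 1) * clifford_cross \<nu> x)) has_real_derivative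
             c * (2 * x powr \<nu> * (clifford \<nu> (- x) * clifford \<nu> x))) (at x)"
      using x assms by (intro DERIV_cmult clifford_cross_deriv) auto
    have "2 * x powr \<nu> * clifford \<nu> x * (c * clifford \<nu> (- x)) > 0"
      using clifford_pos[of \<nu> x] x assms by (intro mult_pos_pos[OF _ pos[OF x]]) auto
    then show "c * (2 * x powr \<nu> * (clifford \<nu> (- x) * clifford \<nu> x)) > 0"
      by (simp add: mult_ac)
  qed
  then show ?thesis by (simp add: mult_ac)
qed

text \<open>
  The heart of the proof. If \<open>K\<^sub>\<nu>(s) = 0\<close>, then \<open>A\<^sub>\<nu> B\<^sub>\<nu> K\<^sub>\<mu>\<close> is the sum of \<open>A\<^sub>\<nu> A\<^sub>\<mu>\<close> times the Casoratian of
  the \<open>B\<close> and \<open>B\<^sub>\<nu> B\<^sub>\<mu>\<close> times the Casoratian of the \<open>A\<close>, and both Casoratians have the sign of \<open>\<nu> - \<mu>\<close>.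
\<close>
lemma clifford_cross_sign_in_order:
  assumes "\<nu> > -1" "s > 0" "clifford_cross \<nu> s = 0"
  shows "\<forall>\<^sub>F \<mu> in at \<nu>. (\<mu> - \<nu>) * (clifford \<nu> (- s) * clifford_cross \<mu> s) < 0"
proof -
  have A: "clifford \<nu> (- s) \<noteq> 0" by (rule clifford_cross_zero_imp[OF assms])
  have "((\<lambda>\<mu>. clifford \<nu> (- s) * clifford \<mu> (- s)) \<longlongrightarrow> clifford \<nu> (- s) * clifford \<nu> (- s)) (at \<nu>)"
    using assms by (intro tendsto_intros) auto
  then have "\<forall>\<^sub>F \<mu> in at \<nu>. clifford \<nu> (- s) * clifford \<mu> (- s) > 0"
    by (rule order_tendstoD(1)) (use A in \<open>auto simp: zero_less_mult_iff\<close>)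
  moreover have "\<forall>\<^sub>F \<mu> in at \<nu>. \<mu> > -1"
    using assms by (intro order_tendstoD(1)[OF tendsto_ident_at]) auto
  moreover have "\<forall>\<^sub>F \<mu> in at \<nu>. \<mu> \<noteq> \<nu>" by (simp add: eventually_at_filter)
  ultimately show ?thesis using casorati_neg_argument_sign[OF assms(1,2)]
  proof eventually_elim
    case (elim \<mu>)
    have B: "clifford \<nu> s > 0" "clifford \<mu> s > 0" using clifford_pos elim assms by auto
    have "(\<mu> - \<nu>) * casorati \<nu> \<mu> (1 * s) < 0"
      using elim assms by (intro casorati_sign clifford_pos) auto
    then have "(\<mu> - \<nu>) * casorati \<nu> \<mu> s * (clifford \<nu> (- s) * clifford \<mu> (- s)) < 0"
      using elim by (intro mult_neg_pos[of "(\<mu> - \<nu>) * casorati \<nu> \<mu> s"]) auto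
    moreover have "(\<mu> - \<nu>) * casorati \<nu> \<mu> (- s) * (clifford \<nu> s * clifford \<mu> s) < 0"
      using elim B by (intro mult_neg_pos[of "(\<mu> - \<nu>) * casorati \<nu> \<mu> (- s)"] mult_pos_pos) auto
    moreover have "clifford \<nu> s * ((\<mu> - \<nu>) * (clifford \<nu> (- s) * clifford_cross \<mu> s)) =
        (\<mu> - \<nu>) * casorati \<nu> \<mu> s * (clifford \<nu> (- s) * clifford \<mu> (- s)) +
        (\<mu> - \<nu>) * casorati \<nu> \<mu> (- s) * (clifford \<nu> s * clifford \<mu> s)"
      using assms(3) unfolding casorati_def clifford_cross_def by algebra
    ultimately have "clifford \<nu> s * ((\<mu> - \<nu>) * (clifford \<nu> (- s) * clifford_cross \<mu> s)) < 0"
      by linarith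
    then show ?case using B by (simp add: mult_less_0_iff)
  qed
qed

text \<open>
  The form in which joint continuity is used: the neighbourhood of \<open>y\<close> does not depend on \<open>u\<close>.
\<close>
lemma eventually_nhds_prod_ball:
  fixes x y :: real
  assumes "\<forall>\<^sub>F p in nhds x \<times>\<^sub>F nhds y. P p"
  obtains e where "e > 0" "\<forall>\<^sub>F u in nhds x. \<forall>v\<in>ball y e. P (u, v)"
proof -
  obtain Pf Pg where Pf: "eventually Pf (nhds x)" and Pg: "eventually Pg (nhds y)"
    and imp: "\<And>u v. Pf u \<Longrightarrow> Pg v \<Longrightarrow> P (u, v)"
    using assms unfolding eventually_prod_filter by blast
  obtain e where e: "e > 0" "\<And>v. dist v y < e \<Longrightarrow> Pg v"
    using Pg unfolding eventually_nhds_metric by blast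
  have "\<forall>\<^sub>F u in nhds x. \<forall>v\<in>ball y e. P (u, v)"
    using Pf by eventually_elim (use imp e in \<open>auto simp: dist_commute\<close>)
  then show ?thesis using that e by blast
qed

lemma clifford_cross_local_nonzero:
  assumes "\<nu> > -1" "clifford_cross \<nu> s \<noteq> 0"
  obtains e where "e > 0" "\<forall>\<^sub>F \<mu> in nhds \<nu>. \<forall>t\<in>ball s e. clifford_cross \<mu> t \<noteq> 0"
proof -
  have "((\<lambda>p. clifford_cross (fst p) (snd p)) \<longlongrightarrow> clifford_cross \<nu> s) (nhds \<nu> \<times>\<^sub>F nhds s)"
    using assms by (intro tendsto_intros filterlim_fst filterlim_snd) auto
  then have "\<forall>\<^sub>F p in nhds \<nu> \<times>\<^sub>F nhds s. clifford_cross (fst p) (snd p) \<noteq> 0"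
    using assms(2) by (rule tendsto_imp_eventually_ne)
  from eventually_nhds_prod_ball[OF this] show ?thesis using that by auto
qed

text \<open>
  Joint continuity of \<open>A\<close> makes the monotonicity uniform in the order: its direction is that at the zero.
\<close>
lemma clifford_cross_local_increasing:
  assumes "\<nu> > -1" "s > 0" "clifford_cross \<nu> s = 0"
  obtains e where "e > 0" "e \<le> s"
    "\<forall>\<^sub>F \<mu> in nhds \<nu>. \<forall>t\<in>ball s e. \<forall>t'\<in>ball s e. t < t' \<longrightarrow>
       t powr (\<mu> + 1) * (clifford \<nu> (- s) * clifford_cross \<mu> t) <
       t' powr (\<mu> + 1) * (clifford \<nu> (- s) * clifford_cross \<mu> t')"
proof -
  define c where "c = clifford \<nu> (- s)"
  have "((\<lambda>p. c * clifford (fst p) (- snd p)) \<longlongrightarrow> c * c) (nhds \<nu> \<times>\<^sub>F nhds s)"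
    unfolding c_def using assms by (intro tendsto_intros filterlim_fst filterlim_snd) auto
  moreover have "c * c > 0"
    using clifford_cross_zero_imp[OF assms] by (auto simp: c_def zero_less_mult_iff)
  ultimately have "\<forall>\<^sub>F p in nhds \<nu> \<times>\<^sub>F nhds s. c * clifford (fst p) (- snd p) > 0"
    by (rule order_tendstoD(1))
  from eventually_nhds_prod_ball[OF this] obtain e where e: "e > 0"
    and ev: "\<forall>\<^sub>F \<mu> in nhds \<nu>. \<forall>t\<in>ball s e. c * clifford \<mu> (- t) > 0" by auto
  have "\<forall>\<^sub>F \<mu> in nhds \<nu>. \<mu> > -1"
    using assms by (intro order_tendstoD(1)[OF tendsto_ident_at, of _ _ UNIV, simplified]
        eventually_nhds_in_open[of "{-1<..}", simplified]) auto
  with ev have "\<forall>\<^sub>F \<mu> in nhds \<nu>. \<forall>t\<in>ball s (min e s). \<forall>t'\<in>ball s (min e s). t < t' \<longrightarrow>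
       t powr (\<mu> + 1) * (c * clifford_cross \<mu> t) < t' powr (\<mu> + 1) * (c * clifford_cross \<mu> t')"
  proof eventually_elim
    case (elim \<mu>)
    then show ?case
      by (intro ballI impI clifford_cross_increasing) (auto simp: dist_real_def)
  qed
  then show ?thesis using that[of "min e s"] e assms by (auto simp: c_def)
qed

text \<open>
  Near a zero of \<open>K\<^sub>\<nu>\<close> the monotonicity leaves room for one zero of \<open>K\<^sub>\<mu>\<close>, and near any other point for
  none. The neighbourhood is the same for all \<open>\<mu>\<close>, so a zero cannot split when the order changes.
\<close>
lemma clifford_cross_zeros_isolated:
  assumes "\<nu> > -1" "s \<ge> 0"
  obtains e where "e > 0"
    "\<forall>\<^sub>F \<mu> in nhds \<nu>. \<forall>t\<in>ball s e. \<forall>t'\<in>ball s e.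
       clifford_cross \<mu> t = 0 \<longrightarrow> clifford_cross \<mu> t' = 0 \<longrightarrow> t = t'"
proof (cases "clifford_cross \<nu> s = 0")
  case False
  then obtain e where e: "e > 0" "\<forall>\<^sub>F \<mu> in nhds \<nu>. \<forall>t\<in>ball s e. clifford_cross \<mu> t \<noteq> 0"
    using clifford_cross_local_nonzero assms by blast
  show ?thesis by (rule that[OF e(1)]) (use e(2) in eventually_elim, auto)
next
  case True
  then have "s > 0" using assms clifford_cross_at_0[of \<nu>] by (cases "s = 0") auto
  then obtain e where e: "e > 0"
    "\<forall>\<^sub>F \<mu> in nhds \<nu>. \<forall>t\<in>ball s e. \<forall>t'\<in>ball s e. t < t' \<longrightarrow>
       t powr (\<mu> + 1) * (clifford \<nu> (- s) * clifford_cross \<mu> t) <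
       t' powr (\<mu> + 1) * (clifford \<nu> (- s) * clifford_cross \<mu> t')"
    using clifford_cross_local_increasing True assms by blast
  show ?thesis
  proof (rule that[OF e(1)])
    show "\<forall>\<^sub>F \<mu> in nhds \<nu>. \<forall>t\<in>ball s e. \<forall>t'\<in>ball s e.
       clifford_cross \<mu> t = 0 \<longrightarrow> clifford_cross \<mu> t' = 0 \<longrightarrow> t = t'"
      using e(2)
    proof eventually_elim
      case (elim \<mu>)
      show ?case
      proof (intro ballI impI)
        fix t t' assume "t \<in> ball s e" "t' \<in> ball s e" "clifford_cross \<mu> t = 0" "clifford_cross \<mu> t' = 0"
        then show "t = t'" using elim by (cases t t' rule: linorder_cases) fastforce+
      qed
    qed
  qed
qed

text \<open>
  After increasing the order, \<open>K\<^sub>\<mu>(s)\<close> has the sign opposite to \<open>A\<^sub>\<nu>(s)\<close>; to the left of \<open>s\<close> the monotone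
  function \<open>t\<^sup>\<mu>\<^sup>+\<^sup>1 K\<^sub>\<mu>(t)\<close> is even further from zero.
\<close>
lemma clifford_cross_zeros_move_right:
  assumes "\<nu> > -1" "s > 0" "clifford_cross \<nu> s = 0"
  obtains e where "e > 0"
    "\<forall>\<^sub>F \<mu> in at_right \<nu>. \<forall>t\<in>ball s e. t \<le> s \<longrightarrow> clifford_cross \<mu> t \<noteq> 0"
proof -
  define c where "c = clifford \<nu> (- s)"
  obtain e where e: "e > 0" "e \<le> s"
    "\<forall>\<^sub>F \<mu> in nhds \<nu>. \<forall>t\<in>ball s e. \<forall>t'\<in>ball s e. t < t' \<longrightarrow>
       t powr (\<mu> + 1) * (c * clifford_cross \<mu> t) < t' powr (\<mu> + 1) * (c * clifford_cross \<mu> t')"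
    using clifford_cross_local_increasing[OF assms] unfolding c_def by blast
  have "\<forall>\<^sub>F \<mu> in at_right \<nu>. (\<mu> - \<nu>) * (c * clifford_cross \<mu> s) < 0"
    using clifford_cross_sign_in_order[OF assms] unfolding c_def by (rule filter_leD[OF at_le, rotated]) auto
  moreover have "\<forall>\<^sub>F \<mu> in at_right \<nu>. \<mu> > \<nu>" by (rule eventually_at_right_less)
  moreover note filter_leD[OF at_within_le_nhds e(3)]
  ultimately have "\<forall>\<^sub>F \<mu> in at_right \<nu>. \<forall>t\<in>ball s e. t \<le> s \<longrightarrow> clifford_cross \<mu> t \<noteq> 0"
  proof eventually_elim
    case (elim \<mu>)
    have neg: "c * clifford_cross \<mu> s < 0" using elim by (simp add: mult_less_0_iff)
    show ?case
    proof (intro ballI impI)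
      fix t assume t: "t \<in> ball s e" "t \<le> s"
      show "clifford_cross \<mu> t \<noteq> 0"
      proof (cases "t = s")
        case True
        then show ?thesis using neg by auto
      next
        case False
        have "t powr (\<mu> + 1) * (c * clifford_cross \<mu> t) < s powr (\<mu> + 1) * (c * clifford_cross \<mu> s)"
          using elim t False e by auto
        also have "\<dots> < 0" using neg assms by (simp add: mult_less_0_iff)
        finally show ?thesis by auto
      qed
    qed
  qed
  then show ?thesis using that e by blast
qed

text \<open>
  After decreasing the order, \<open>K\<^sub>\<mu>(s)\<close> has the sign of \<open>A\<^sub>\<nu>(s)\<close>, while a little to the left of \<open>s\<close> the opposite
  sign of \<open>K\<^sub>\<nu>\<close> persists by continuity.
\<close>
lemma clifford_cross_zeros_move_left:
  assumes "\<nu> > -1" "s > 0" "clifford_cross \<nu> s = 0" "d > 0"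
  shows "\<forall>\<^sub>F \<mu> in at_left \<nu>. \<exists>t. s - d < t \<and> t < s \<and> 0 < t \<and> clifford_cross \<mu> t = 0"
proof -
  define c where "c = clifford \<nu> (- s)"
  obtain e where e: "e > 0" "e \<le> s"
    "\<forall>\<^sub>F \<mu> in nhds \<nu>. \<forall>t\<in>ball s e. \<forall>t'\<in>ball s e. t < t' \<longrightarrow>
       t powr (\<mu> + 1) * (c * clifford_cross \<mu> t) < t' powr (\<mu> + 1) * (c * clifford_cross \<mu> t')"
    using clifford_cross_local_increasing[OF assms(1-3)] unfolding c_def by blast
  \<comment> \<open>A point to the left of the zero, both within \<open>d\<close> of it and inside the region of monotonicity.\<close>
  define r where "r = s - min d e / 2"
  have r: "s - d < r" "0 < r" "r < s" "r \<in> ball s e"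
    using e assms by (auto simp: r_def dist_real_def)
  have "r powr (\<nu> + 1) * (c * clifford_cross \<nu> r) < s powr (\<nu> + 1) * (c * clifford_cross \<nu> s)"
    using eventually_nhds_x_imp_x[OF e(3)] r e by auto
  then have "c * clifford_cross \<nu> r < 0"
    using assms(3) r by (simp add: mult_less_0_iff)
  moreover have "((\<lambda>\<mu>. c * clifford_cross \<mu> r) \<longlongrightarrow> c * clifford_cross \<nu> r) (at_left \<nu>)"
    using assms by (intro tendsto_intros) auto
  ultimately have "\<forall>\<^sub>F \<mu> in at_left \<nu>. c * clifford_cross \<mu> r < 0"
    by (metis order_tendstoD(2))
  moreover have "\<forall>\<^sub>F \<mu> in at_left \<nu>. (\<mu> - \<nu>) * (c * clifford_cross \<mu> s) < 0"
    using clifford_cross_sign_in_order[OF assms(1-3)] unfolding c_def by (rule filter_leD[OF at_le, rotated]) auto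
  moreover have "\<forall>\<^sub>F \<mu> in at_left \<nu>. \<mu> < \<nu>" by (simp add: eventually_at_filter)
  moreover have "\<forall>\<^sub>F \<mu> in at_left \<nu>. \<mu> > -1"
    using assms by (intro order_tendstoD(1)[OF tendsto_ident_at]) auto
  ultimately show ?thesis
  proof eventually_elim
    case (elim \<mu>)
    have "c * clifford_cross \<mu> s > 0" using elim by (simp add: mult_less_0_iff)
    moreover have "continuous_on {r..s} (\<lambda>t. c * clifford_cross \<mu> t)"
      using elim by (intro continuous_intros continuous_on_clifford_cross) auto
    ultimately obtain t where t: "r \<le> t" "t \<le> s" "c * clifford_cross \<mu> t = 0"
      using IVT'[of "\<lambda>t. c * clifford_cross \<mu> t" r 0 s] elim r by auto
    moreover have "t \<noteq> s" "c \<noteq> 0" using t \<open>c * clifford_cross \<mu> s > 0\<close> by auto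
    ultimately show ?case using r by (intro exI[of _ t]) auto
  qed
qed

section \<open>Translation from the Bessel functions\<close>

lemma bessel_J_eq_clifford: "bessel_J \<nu> z = (z / 2) powr \<nu> * clifford \<nu> (- ((z / 2)\<^sup>2))"
proof -
  have "(- 1) ^ k * c / fact k * (z / 2) ^ (2 * k) = c / fact k * (- ((z / 2)\<^sup>2)) ^ k"
    for k and c :: real
    unfolding power_mult[of "z / 2" 2 k] power_minus[of "(z / 2)\<^sup>2"]
    by (simp only: times_divide_eq_left times_divide_eq_right mult_ac)
  then show ?thesis unfolding bessel_J_def clifford_def by (simp only:)
qed

lemma bessel_I_eq_clifford: "bessel_I \<nu> z = (z / 2) powr \<nu> * clifford \<nu> ((z / 2)\<^sup>2)"
  unfolding bessel_I_def clifford_def by (simp add: power_mult)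

lemma bessel_cross_eq:
  assumes "\<nu> > -1" "z > 0"
  shows "bessel_cross \<nu> z = (z / 2) * ((z / 2) powr \<nu>)\<^sup>2 * clifford_cross \<nu> ((z / 2)\<^sup>2)"
proof -
  let ?s = "(z / 2)\<^sup>2"
  have "(bessel_J \<nu> has_real_derivative
      (\<nu> * (z / 2) powr (\<nu> - 1) / 2) * clifford \<nu> (- ?s)
      - (z / 2) powr \<nu> * (clifford (\<nu> + 1) (- ?s) * (z / 2))) (at z)"
    unfolding bessel_J_eq_clifford[abs_def] using assms
    by (auto intro!: derivative_eq_intros simp: power2_eq_square algebra_simps)
  note J = DERIV_imp_deriv[OF this]
  have "(bessel_I \<nu> has_real_derivative
      (\<nu> * (z / 2) powr (\<nu> - 1) / 2) * clifford \<nu> ?s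
      + (z / 2) powr \<nu> * (clifford (\<nu> + 1) ?s * (z / 2))) (at z)"
    unfolding bessel_I_eq_clifford[abs_def] using assms
    by (auto intro!: derivative_eq_intros simp: power2_eq_square algebra_simps)
  note I = DERIV_imp_deriv[OF this]
  have "p * A * (d * B + p * (B' * w)) - (d * A - p * (A' * w)) * (p * B)
          = w * p\<^sup>2 * (A * B' + A' * B)" for p d w A B A' B' :: real
    by (simp add: power2_eq_square algebra_simps)
  then show ?thesis
    unfolding bessel_cross_def J I bessel_J_eq_clifford bessel_I_eq_clifford clifford_cross_def .
qed

lemma is_nth_pos_zero_bessel_cross:
  assumes "\<nu> > -1" "s > 0" "is_nth_pos_zero (clifford_cross \<nu>) n s"
  shows "is_nth_pos_zero (bessel_cross \<nu>) n (2 * sqrt s)"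
proof -
  have zero: "bessel_cross \<nu> z = 0 \<longleftrightarrow> clifford_cross \<nu> ((z / 2)\<^sup>2) = 0" if "z > 0" for z
    unfolding bessel_cross_eq[OF assms(1) that] using that by simp
  have "bij_betw (\<lambda>t. 2 * sqrt t) {t. 0 < t \<and> t \<le> s \<and> clifford_cross \<nu> t = 0}
          {z. 0 < z \<and> z \<le> 2 * sqrt s \<and> bessel_cross \<nu> z = 0}"
  proof (rule bij_betw_byWitness[where f' = "\<lambda>z. (z / 2)\<^sup>2"])
    show "(\<lambda>z. (z / 2)\<^sup>2) ` {z. 0 < z \<and> z \<le> 2 * sqrt s \<and> bessel_cross \<nu> z = 0}
            \<subseteq> {t. 0 < t \<and> t \<le> s \<and> clifford_cross \<nu> t = 0}"
    proof (intro image_subsetI CollectI conjI)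
      fix z assume z: "z \<in> {z. 0 < z \<and> z \<le> 2 * sqrt s \<and> bessel_cross \<nu> z = 0}"
      then have "(z / 2)\<^sup>2 \<le> (sqrt s)\<^sup>2" by (intro power_mono) auto
      then show "(z / 2)\<^sup>2 \<le> s" using assms by simp
    qed (auto simp: zero)
  qed (auto simp: zero)
  from bij_betw_same_card[OF this] bij_betw_finite[OF this] show ?thesis
    using assms(2,3) zero[of "2 * sqrt s"] unfolding is_nth_pos_zero_def by simp
qed

section \<open>Existence of arbitrarily large zeros\<close>

text \<open>
  Beyond a last zero the ratio \<open>p = J\<^sub>\<nu>\<^sub>+\<^sub>1 / J\<^sub>\<nu>\<close> would be smooth and satisfy \<open>p' = 1 + p\<^sup>2 - (2\<nu> + 1) p / z\<close>. For
  \<open>z \<ge> \<bar>2\<nu> + 1\<bar>\<close> the right-hand side is at least \<open>(1 + p\<^sup>2) / 2\<close>, so that \<open>arctan p\<close> has slope at least \<open>1/2\<close>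
  and increases by at least 4 on an interval of length 8, although its range has length \<open>\<pi> < 4\<close>.
\<close>
lemma clifford_neg_zeros_unbounded:
  assumes "\<nu> > -1" "b \<ge> 0"
  shows "\<exists>s>b. clifford \<nu> (- s) = 0"
proof (rule ccontr)
  assume no: "\<not> ?thesis"
  \<comment> \<open>The first summand gives \<open>(z / 2)\<^sup>2 > b\<close> for \<open>z \<ge> z0\<close>, the second gives the bound on \<open>(2 * \<nu> + 1) / z\<close>.\<close>
  define z0 where "z0 = 2 * (b + 1) + \<bar>2 * \<nu> + 1\<bar>"
  have nz: "clifford \<nu> (- ((z / 2)\<^sup>2)) \<noteq> 0" if "z \<ge> z0" for z
  proof -
    have "b + 1 \<le> z / 2" using that by (simp add: z0_def)
    then have "(b + 1)\<^sup>2 \<le> (z / 2)\<^sup>2" using assms by (intro power_mono) auto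
    moreover have "b < (b + 1)\<^sup>2" using assms by (simp add: power2_eq_square algebra_simps add_pos_nonneg)
    ultimately show ?thesis using no by auto
  qed
  define p where "p z = (z / 2) * clifford (\<nu> + 1) (- ((z / 2)\<^sup>2)) / clifford \<nu> (- ((z / 2)\<^sup>2))" for z
  have p': "(p has_real_derivative 1 + (p z)\<^sup>2 - (2 * \<nu> + 1) / z * p z) (at z)" if "z \<ge> z0" for z
  proof -
    have z: "z > 0" using that assms by (auto simp: z0_def)
    let ?A = "\<lambda>\<kappa>. clifford \<kappa> (- ((z / 2)\<^sup>2))"
    have A: "?A \<nu> \<noteq> 0" by (rule nz[OF that])
    have dA: "((\<lambda>z. clifford \<kappa> (- ((z / 2)\<^sup>2))) has_real_derivative - (?A (\<kappa> + 1) * (z / 2))) (at z)"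
      if "\<kappa> > -1" for \<kappa>
      using that by (auto intro!: derivative_eq_intros)
    have "(p has_real_derivative
        ((1 / 2 * ?A (\<nu> + 1) + - (?A (\<nu> + 1 + 1) * (z / 2)) * (z / 2)) * ?A \<nu>
         - z / 2 * ?A (\<nu> + 1) * - (?A (\<nu> + 1) * (z / 2))) / (?A \<nu> * ?A \<nu>)) (at z)"
      unfolding p_def[abs_def] using assms A
      by (intro DERIV_divide DERIV_mult DERIV_cdivide DERIV_ident dA) auto
    moreover have "(1 / 2 * ?A (\<nu> + 1) + - (?A (\<nu> + 1 + 1) * (z / 2)) * (z / 2)) * ?A \<nu>
         - z / 2 * ?A (\<nu> + 1) * - (?A (\<nu> + 1) * (z / 2))
         = (1 + (p z)\<^sup>2 - (2 * \<nu> + 1) / z * p z) * (?A \<nu> * ?A \<nu>)"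
    proof -
      define q where "q = ?A (\<nu> + 1) / ?A \<nu>"
      have q: "?A (\<nu> + 1) = q * ?A \<nu>" "p z = z / 2 * q" using A by (auto simp: q_def p_def)
      have "?A \<nu> = (\<nu> + 1) * ?A (\<nu> + 1) + - ((z / 2)\<^sup>2) * ?A (\<nu> + 1 + 1)"
        using assms by (intro clifford_recurrence)
      then have "?A (\<nu> + 1 + 1) * (z / 2) * (z / 2) = (\<nu> + 1) * (q * ?A \<nu>) - ?A \<nu>"
        unfolding q(1) by (simp only: power2_eq_square) (simp only: minus_mult_left[symmetric] mult_ac)
      then show ?thesis
        using z unfolding q mult_minus_left
        by (simp only:) (simp add: field_simps power2_eq_square)
    qed
    ultimately show ?thesis using A by simp
  qed
  have slope: "1 / 2 \<le> (1 + (p z)\<^sup>2 - (2 * \<nu> + 1) / z * p z) / (1 + (p z)\<^sup>2)" if "z \<ge> z0" for z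
  proof -
    have z: "\<bar>2 * \<nu> + 1\<bar> \<le> z" "z > 0" using that assms unfolding z0_def by auto
    then have "\<bar>(2 * \<nu> + 1) / z\<bar> \<le> 1" unfolding abs_divide by simp
    then have "\<bar>(2 * \<nu> + 1) / z\<bar> * \<bar>p z\<bar> \<le> 1 * \<bar>p z\<bar>" by (rule mult_right_mono) simp
    then have "(2 * \<nu> + 1) / z * p z \<le> \<bar>p z\<bar>" unfolding abs_mult[symmetric] by linarith
    moreover have "2 * \<bar>p z\<bar> \<le> 1 + (p z)\<^sup>2"
      using zero_le_power2[of "\<bar>p z\<bar> - 1"] by (simp add: power2_diff)
    ultimately have "1 / 2 * (1 + (p z)\<^sup>2) \<le> 1 + (p z)\<^sup>2 - (2 * \<nu> + 1) / z * p z" by argo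
    moreover have "1 + (p z)\<^sup>2 > 0" by (intro add_pos_nonneg) auto
    ultimately show ?thesis by (simp only: pos_le_divide_eq)
  qed
  have "\<exists>x. z0 < x \<and> x < z0 + 8 \<and> arctan (p (z0 + 8)) - arctan (p z0) =
     (z0 + 8 - z0) * ((1 + (p x)\<^sup>2 - (2 * \<nu> + 1) / x * p x) / (1 + (p x)\<^sup>2))"
    by (rule MVT2) (auto intro!: derivative_eq_intros p' simp: divide_inverse mult_ac)
  then obtain x where "z0 < x" "arctan (p (z0 + 8)) - arctan (p z0) =
     8 * ((1 + (p x)\<^sup>2 - (2 * \<nu> + 1) / x * p x) / (1 + (p x)\<^sup>2))" by auto
  then have "4 \<le> arctan (p (z0 + 8)) - arctan (p z0)" using slope[of x] by linarith
  then show False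
    using arctan_bounded[of "p (z0 + 8)"] arctan_bounded[of "p z0"] pi_less_4 by linarith
qed

text \<open>
  The derivative of \<open>A\<^sub>\<nu> / B\<^sub>\<nu>\<close> is \<open>-K\<^sub>\<nu> / B\<^sub>\<nu>\<^sup>2\<close>, so \<open>K\<^sub>\<nu>\<close> vanishes between two zeros of \<open>A\<^sub>\<nu>\<close>.
\<close>
lemma clifford_cross_zeros_unbounded:
  assumes "\<nu> > -1" "b \<ge> 0"
  shows "\<exists>s>b. clifford_cross \<nu> s = 0"
proof -
  obtain s where s: "s > b" "clifford \<nu> (- s) = 0"
    using clifford_neg_zeros_unbounded[OF assms] by blast
  obtain t where t: "t > s" "clifford \<nu> (- t) = 0"
    using clifford_neg_zeros_unbounded[of \<nu> s] s assms by auto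
  let ?u = "\<lambda>x. clifford \<nu> (- x) / clifford \<nu> x"
  have u': "(?u has_real_derivative - clifford_cross \<nu> x / (clifford \<nu> x)\<^sup>2) (at x)" if "x \<ge> s" for x
    using assms s that clifford_pos[of \<nu> x]
    by (auto intro!: derivative_eq_intros simp: clifford_cross_def power2_eq_square algebra_simps)
  have "\<exists>x. s < x \<and> x < t \<and> DERIV ?u x :> 0"
  proof (rule Rolle)
    show "continuous_on {s..t} ?u"
      by (rule DERIV_atLeastAtMost_imp_continuous_on) (use u' in auto)
    show "?u differentiable (at x)" if "s < x" "x < t" for x
      using u'[of x] that by (auto simp: real_differentiable_def)
  qed (use s t in auto)
  then obtain x where x: "s < x" "DERIV ?u x :> 0" by blast
  then have "clifford_cross \<nu> x / (clifford \<nu> x)\<^sup>2 = 0"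
    using DERIV_unique[OF x(2) u'[of x]] by simp
  then have "clifford_cross \<nu> x = 0"
    using clifford_pos[of \<nu> x] x s assms by simp
  then show ?thesis using x s by (intro exI[of _ x]) auto
qed

section \<open>Counting zeros\<close>

definition zeros_upto :: "real \<Rightarrow> real \<Rightarrow> real set" where
  "zeros_upto \<nu> s = {t. 0 < t \<and> t \<le> s \<and> clifford_cross \<nu> t = 0}"

lemma at_most_one_card:
  assumes "\<And>x y. x \<in> A \<Longrightarrow> y \<in> A \<Longrightarrow> x = y"
  shows "finite A \<and> card A \<le> 1"
proof (cases "A = {}")
  case False
  then obtain x where "A = {x}" using assms by blast
  then show ?thesis by simp
qed auto

lemma finite_ball_cover:
  fixes X :: "real set"
  assumes "compact X" "\<forall>t\<in>X. \<exists>e>0. P t e"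
  obtains T e where "finite T" "X \<subseteq> (\<Union>t\<in>T. ball t (e t))" "\<And>t. t \<in> T \<Longrightarrow> P t (e t)"
proof -
  obtain e where e: "\<And>t. t \<in> X \<Longrightarrow> e t > 0 \<and> P t (e t)" using assms(2) by metis
  then have "X \<subseteq> (\<Union>t\<in>X. ball t (e t))" by fastforce
  then obtain T where "T \<subseteq> X" "finite T" "X \<subseteq> (\<Union>t\<in>T. ball t (e t))"
    using compactE_image[OF assms(1), of X "\<lambda>t. ball t (e t)"] open_ball by metis
  then show ?thesis using that e by blast
qed

lemma finite_zeros_upto:
  assumes "\<nu> > -1"
  shows "finite (zeros_upto \<nu> s)"
proof -
  have "\<forall>t\<in>{0..s}. \<exists>e>0. finite (zeros_upto \<nu> s \<inter> ball t e)"
  proof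
    fix t assume "t \<in> {0..s}"
    then have "t \<ge> 0" by simp
    from clifford_cross_zeros_isolated[OF assms this] obtain e where e: "e > 0"
      "\<forall>\<^sub>F \<mu> in nhds \<nu>. \<forall>u\<in>ball t e. \<forall>u'\<in>ball t e.
         clifford_cross \<mu> u = 0 \<longrightarrow> clifford_cross \<mu> u' = 0 \<longrightarrow> u = u'" by blast
    have "finite (zeros_upto \<nu> s \<inter> ball t e)"
      by (rule at_most_one_card[THEN conjunct1])
         (use eventually_nhds_x_imp_x[OF e(2)] in \<open>auto simp: zeros_upto_def\<close>)
    then show "\<exists>e>0. finite (zeros_upto \<nu> s \<inter> ball t e)" using e by blast
  qed
  from finite_ball_cover[OF compact_Icc this] obtain T e where T: "finite T"
    "{0..s} \<subseteq> (\<Union>t\<in>T. ball t (e t))"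
    "\<And>t. t \<in> T \<Longrightarrow> finite (zeros_upto \<nu> s \<inter> ball t (e t))" by blast
  have "zeros_upto \<nu> s \<subseteq> {0..s}" by (auto simp: zeros_upto_def)
  then have "zeros_upto \<nu> s \<subseteq> (\<Union>t\<in>T. zeros_upto \<nu> s \<inter> ball t (e t))"
    using T(2) by blast
  then show ?thesis
    by (rule finite_subset) (intro finite_UN_I T)
qed

text \<open>
  The interval \<open>[0, s]\<close> is covered by finitely many balls such that each ball contains, for all \<open>\<mu>\<close> slightly
  above \<open>\<nu>\<close>, at most one zero of \<open>K\<^sub>\<mu>\<close>, and even none unless its centre is a zero of \<open>K\<^sub>\<nu>\<close> other than \<open>s\<close>.
  Balls may overlap, which does no harm for an upper bound.
\<close>
lemma card_zeros_upto_right: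
  assumes "\<nu> > -1" "s > 0" "clifford_cross \<nu> s = 0"
  shows "\<forall>\<^sub>F \<mu> in at_right \<nu>. card (zeros_upto \<mu> s) < card (zeros_upto \<nu> s)"
proof -
  define c where "c t = (if t \<in> zeros_upto \<nu> s - {s} then 1 else 0 :: nat)" for t
  have "\<forall>t\<in>{0..s}. \<exists>e>0. \<forall>\<^sub>F \<mu> in at_right \<nu>. card (zeros_upto \<mu> s \<inter> ball t e) \<le> c t"
  proof
    fix t assume t: "t \<in> {0..s}"
    consider "clifford_cross \<nu> t \<noteq> 0" | "t = s" | "t \<in> zeros_upto \<nu> s - {s}"
      using t clifford_cross_at_0[OF assms(1)] by (cases "t = 0") (auto simp: zeros_upto_def)
    then show "\<exists>e>0. \<forall>\<^sub>F \<mu> in at_right \<nu>. card (zeros_upto \<mu> s \<inter> ball t e) \<le> c t"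
    proof cases
      case 1
      then obtain e where e: "e > 0" "\<forall>\<^sub>F \<mu> in nhds \<nu>. \<forall>u\<in>ball t e. clifford_cross \<mu> u \<noteq> 0"
        using clifford_cross_local_nonzero[OF assms(1)] by blast
      from filter_leD[OF at_within_le_nhds e(2)]
      have "\<forall>\<^sub>F \<mu> in at_right \<nu>. card (zeros_upto \<mu> s \<inter> ball t e) \<le> c t"
      proof eventually_elim
        case (elim \<mu>)
        then have "zeros_upto \<mu> s \<inter> ball t e = {}" by (auto simp: zeros_upto_def)
        then show ?case by (simp only: card.empty)
      qed
      then show ?thesis using e by blast
    next
      case 2
      then obtain e where e: "e > 0"
        "\<forall>\<^sub>F \<mu> in at_right \<nu>. \<forall>u\<in>ball t e. u \<le> t \<longrightarrow> clifford_cross \<mu> u \<noteq> 0"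
        using clifford_cross_zeros_move_right[OF assms] by blast
      from e(2) have "\<forall>\<^sub>F \<mu> in at_right \<nu>. card (zeros_upto \<mu> s \<inter> ball t e) \<le> c t"
      proof eventually_elim
        case (elim \<mu>)
        then have "zeros_upto \<mu> s \<inter> ball t e = {}" using 2 by (auto simp: zeros_upto_def)
        then show ?case by (simp only: card.empty)
      qed
      then show ?thesis using e by blast
    next
      case 3
      have "t \<ge> 0" using t by simp
      from clifford_cross_zeros_isolated[OF assms(1) this] obtain e where e: "e > 0"
        "\<forall>\<^sub>F \<mu> in nhds \<nu>. \<forall>u\<in>ball t e. \<forall>u'\<in>ball t e.
           clifford_cross \<mu> u = 0 \<longrightarrow> clifford_cross \<mu> u' = 0 \<longrightarrow> u = u'" by blast
      from filter_leD[OF at_within_le_nhds e(2)]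
      have "\<forall>\<^sub>F \<mu> in at_right \<nu>. card (zeros_upto \<mu> s \<inter> ball t e) \<le> c t"
      proof eventually_elim
        case (elim \<mu>)
        have "card (zeros_upto \<mu> s \<inter> ball t e) \<le> 1"
          by (rule at_most_one_card[THEN conjunct2]) (use elim in \<open>auto simp: zeros_upto_def\<close>)
        then show ?case using 3 by (simp add: c_def)
      qed
      then show ?thesis using e by blast
    qed
  qed
  from finite_ball_cover[OF compact_Icc this] obtain T e where T: "finite T"
    "{0..s} \<subseteq> (\<Union>t\<in>T. ball t (e t))"
    "\<And>t. t \<in> T \<Longrightarrow> \<forall>\<^sub>F \<mu> in at_right \<nu>. card (zeros_upto \<mu> s \<inter> ball t (e t)) \<le> c t"
    by blast
  have "\<forall>\<^sub>F \<mu> in at_right \<nu>. \<forall>t\<in>T. card (zeros_upto \<mu> s \<inter> ball t (e t)) \<le> c t"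
    using T by (intro eventually_ball_finite) auto
  then show ?thesis
  proof eventually_elim
    case (elim \<mu>)
    have "zeros_upto \<mu> s \<subseteq> {0..s}" by (auto simp: zeros_upto_def)
    then have "zeros_upto \<mu> s = (\<Union>t\<in>T. zeros_upto \<mu> s \<inter> ball t (e t))"
      using T(2) by blast
    then have "card (zeros_upto \<mu> s) \<le> (\<Sum>t\<in>T. card (zeros_upto \<mu> s \<inter> ball t (e t)))"
      using card_UN_le[OF T(1), of "\<lambda>t. zeros_upto \<mu> s \<inter> ball t (e t)"] by simp
    also have "\<dots> \<le> (\<Sum>t\<in>T. c t)" using elim by (intro sum_mono) auto
    also have "\<dots> = card (T \<inter> (zeros_upto \<nu> s - {s}))"
      using T(1) by (simp add: c_def sum.If_cases Int_def)
    also have "\<dots> \<le> card (zeros_upto \<nu> s - {s})"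
      using finite_zeros_upto[OF assms(1)] by (intro card_mono) auto
    also have "\<dots> < card (zeros_upto \<nu> s)"
      using finite_zeros_upto[OF assms(1)] assms
      by (intro card_Diff1_less) (auto simp: zeros_upto_def)
    finally show ?case .
  qed
qed

text \<open>
  Each zero of \<open>K\<^sub>\<nu>\<close> gives a zero of \<open>K\<^sub>\<mu>\<close> to its left, within a distance \<open>d\<close> not exceeding any gap between two
  zeros of \<open>K\<^sub>\<nu>\<close>, so that different zeros give different ones. The new zeros are smaller than \<open>s\<close>, which is
  why \<open>s\<close> may be removed.
\<close>
lemma card_zeros_upto_left:
  assumes "\<nu> > -1"
  shows "\<forall>\<^sub>F \<mu> in at_left \<nu>. card (zeros_upto \<nu> s) \<le> card (zeros_upto \<mu> s - {s})"
proof -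
  let ?Z = "zeros_upto \<nu> s"
  have fin: "finite ?Z" by (rule finite_zeros_upto[OF assms])
  obtain d where d: "d > 0" "\<And>x y. x \<in> ?Z \<Longrightarrow> y \<in> ?Z \<Longrightarrow> x < y \<Longrightarrow> d \<le> y - x"
  proof -
    \<comment> \<open>The number 1 is added to make the set of gaps nonempty.\<close>
    define D where "D = insert 1 ((\<lambda>(x, y). y - x) ` {p \<in> ?Z \<times> ?Z. fst p < snd p})"
    have "finite D" unfolding D_def using fin by auto
    moreover have "\<And>u. u \<in> D \<Longrightarrow> u > 0" "D \<noteq> {}" by (auto simp: D_def)
    ultimately have "Min D > 0" by simp
    moreover have "Min D \<le> y - x" if "x \<in> ?Z" "y \<in> ?Z" "x < y" for x y
      using \<open>finite D\<close> that by (intro Min_le) (auto simp: D_def intro!: image_eqI[of _ _ "(x, y)"])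
    ultimately show ?thesis using that by blast
  qed
  have "\<forall>\<^sub>F \<mu> in at_left \<nu>. \<forall>x\<in>?Z. \<exists>t. x - d < t \<and> t < x \<and> 0 < t \<and> clifford_cross \<mu> t = 0"
    using fin by (intro eventually_ball_finite ballI clifford_cross_zeros_move_left)
      (use assms d in \<open>auto simp: zeros_upto_def\<close>)
  moreover have "\<forall>\<^sub>F \<mu> in at_left \<nu>. \<mu> > -1"
    using assms by (intro order_tendstoD(1)[OF tendsto_ident_at]) auto
  ultimately show ?thesis
  proof eventually_elim
    case (elim \<mu>)
    then obtain h where h: "\<And>x. x \<in> ?Z \<Longrightarrow> x - d < h x \<and> h x < x \<and> 0 < h x \<and> clifford_cross \<mu> (h x) = 0"
      by metis
    have "inj_on h ?Z"
    proof (rule linorder_inj_onI)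
      fix x y assume "x < y" "x \<in> ?Z" "y \<in> ?Z"
      then show "h x \<noteq> h y" using d(2)[of x y] h[of x] h[of y] by auto
    qed auto
    moreover have "h ` ?Z \<subseteq> zeros_upto \<mu> s - {s}"
      using h by (force simp: zeros_upto_def)
    moreover have "finite (zeros_upto \<mu> s)" using elim by (intro finite_zeros_upto)
    ultimately show ?case by (intro card_inj_on_le) auto
  qed
qed

text \<open>
  For \<open>n = 0\<close> the point 0 serves as the start of the induction; each next zero is the smallest one beyond
  the previous.
\<close>
lemma nth_zero_exists:
  assumes "\<nu> > -1"
  shows "\<exists>s\<ge>0. card (zeros_upto \<nu> s) = n \<and> (n > 0 \<longrightarrow> s > 0 \<and> clifford_cross \<nu> s = 0)"
proof (induction n)
  case 0
  have "zeros_upto \<nu> 0 = {}" by (auto simp: zeros_upto_def)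
  then show ?case by (intro exI[of _ 0]) simp
next
  case (Suc n)
  then obtain s where s: "s \<ge> 0" "card (zeros_upto \<nu> s) = n" by blast
  obtain b where b: "b > s" "clifford_cross \<nu> b = 0"
    using clifford_cross_zeros_unbounded[OF assms s(1)] by blast
  define X where "X = zeros_upto \<nu> b \<inter> {s<..}"
  have X: "finite X" "X \<noteq> {}"
  proof -
    show "finite X" unfolding X_def using finite_zeros_upto[OF assms] by blast
    have "b \<in> X" using b s by (simp add: X_def zeros_upto_def)
    then show "X \<noteq> {}" by blast
  qed
  define t where "t = Min X"
  have t: "t \<in> X" "\<And>u. u \<in> X \<Longrightarrow> t \<le> u" using X by (auto simp: t_def)
  have "zeros_upto \<nu> t = insert t (zeros_upto \<nu> s)"
    using t s by (force simp: zeros_upto_def X_def)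
  moreover have "t \<notin> zeros_upto \<nu> s" using t by (auto simp: zeros_upto_def X_def)
  ultimately have "card (zeros_upto \<nu> t) = Suc n"
    using s finite_zeros_upto[OF assms] by simp
  then show ?case using t s by (intro exI[of _ t]) (auto simp: X_def zeros_upto_def)
qed

lemma is_nth_pos_zero_clifford_cross_iff:
  assumes "\<nu> > -1"
  shows "is_nth_pos_zero (clifford_cross \<nu>) n s \<longleftrightarrow>
           s > 0 \<and> clifford_cross \<nu> s = 0 \<and> card (zeros_upto \<nu> s) = n"
  using finite_zeros_upto[OF assms, of s] unfolding is_nth_pos_zero_def zeros_upto_def by auto

text \<open>
  The comparison with a fixed \<open>x\<close> on either side passes to any pair of points by bisection.
\<close>
lemma strict_mono_on_locally:
  fixes g :: "real \<Rightarrow> real"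
  assumes right: "\<And>x. a < x \<Longrightarrow> \<forall>\<^sub>F y in at_right x. g x < g y"
      and left: "\<And>x. a < x \<Longrightarrow> \<forall>\<^sub>F y in at_left x. g y < g x"
  shows "strict_mono_on {a<..} g"
proof (rule strict_mono_onI)
  fix x y assume xy: "x \<in> {a<..}" "y \<in> {a<..}" "x < y"
  have "x < y \<longrightarrow> g x < g y"
  proof (rule Bolzano[of x y "\<lambda>x y. x < y \<longrightarrow> g x < g y"])
    fix w assume w: "x \<le> w" "w \<le> y"
    obtain d1 where d1: "d1 > w" "\<And>v. w < v \<Longrightarrow> v < d1 \<Longrightarrow> g w < g v"
      using right[of w] xy w by (auto simp: eventually_at_right_field)
    obtain d2 where d2: "d2 < w" "\<And>v. d2 < v \<Longrightarrow> v < w \<Longrightarrow> g v < g w"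
      using left[of w] xy w by (auto simp: eventually_at_left_field)
    have "u < v \<longrightarrow> g u < g v" if "u \<le> w" "w \<le> v" "v - u < min (d1 - w) (w - d2)" for u v
      using d1(2)[of v] d2(2)[of u] that by (cases "u = w"; cases "w = v") auto
    then show "\<exists>d>0. \<forall>u v. u \<le> w \<and> w \<le> v \<and> v - u < d \<longrightarrow> (u < v \<longrightarrow> g u < g v)"
      using d1 d2 by (intro exI[of _ "min (d1 - w) (w - d2)"]) auto
  qed (use xy in force)+
  then show "g x < g y" using xy by simp
qed

theorem lemma4:
  fixes n :: nat
  assumes "n \<ge> 1"
  shows "(\<forall>\<nu>>-1. is_nth_pos_zero (bessel_cross \<nu>) n (nth_pos_zero (bessel_cross \<nu>) n)) \<and>
         strict_mono_on {-1<..} (\<lambda>\<nu>. nth_pos_zero (bessel_cross \<nu>) n)"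
proof -
  have "\<forall>\<nu>\<in>{-1<..}. \<exists>s>0. clifford_cross \<nu> s = 0 \<and> card (zeros_upto \<nu> s) = n"
    using nth_zero_exists[of _ n] assms by force
  then obtain g where g: "\<And>\<nu>. \<nu> > -1 \<Longrightarrow>
      g \<nu> > 0 \<and> clifford_cross \<nu> (g \<nu>) = 0 \<and> card (zeros_upto \<nu> (g \<nu>)) = n"
    by (metis greaterThan_iff)
  have nth: "is_nth_pos_zero (bessel_cross \<nu>) n (2 * sqrt (g \<nu>))" if "\<nu> > -1" for \<nu>
    using g[OF that] that
    by (intro is_nth_pos_zero_bessel_cross) (auto simp: is_nth_pos_zero_clifford_cross_iff)
  have mono: "strict_mono_on {-1<..} g"
  proof (rule strict_mono_on_locally)
    fix \<nu> :: real assume \<nu>: "-1 < \<nu>"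
    have "\<forall>\<^sub>F \<mu> in at_right \<nu>. \<mu> > \<nu>" by (rule eventually_at_right_less)
    moreover have "\<forall>\<^sub>F \<mu> in at_right \<nu>. card (zeros_upto \<mu> (g \<nu>)) < n"
      using card_zeros_upto_right[OF \<nu>] g[OF \<nu>] by auto
    ultimately show "\<forall>\<^sub>F \<mu> in at_right \<nu>. g \<nu> < g \<mu>"
    proof eventually_elim
      case (elim \<mu>)
      show ?case
      proof (rule ccontr)
        assume "\<not> g \<nu> < g \<mu>"
        then have "zeros_upto \<mu> (g \<mu>) \<subseteq> zeros_upto \<mu> (g \<nu>)" by (auto simp: zeros_upto_def)
        then have "n \<le> card (zeros_upto \<mu> (g \<nu>))"
          using g[of \<mu>] finite_zeros_upto[of \<mu>] elim \<nu> by (metis card_mono less_trans)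
        then show False using elim by simp
      qed
    qed
    have "\<forall>\<^sub>F \<mu> in at_left \<nu>. \<mu> > -1"
      using \<nu> by (intro order_tendstoD(1)[OF tendsto_ident_at]) auto
    moreover have "\<forall>\<^sub>F \<mu> in at_left \<nu>. n \<le> card (zeros_upto \<mu> (g \<nu>) - {g \<nu>})"
      using card_zeros_upto_left[OF \<nu>, of "g \<nu>"] g[OF \<nu>] by auto
    ultimately show "\<forall>\<^sub>F \<mu> in at_left \<nu>. g \<mu> < g \<nu>"
    proof eventually_elim
      case (elim \<mu>)
      show ?case
      proof (rule ccontr)
        assume *: "\<not> g \<mu> < g \<nu>"
        have "zeros_upto \<mu> (g \<nu>) - {g \<nu>} \<subseteq> zeros_upto \<mu> (g \<mu>) - {g \<mu>}"
          using * by (auto simp: zeros_upto_def)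
        then have "n \<le> card (zeros_upto \<mu> (g \<mu>) - {g \<mu>})"
          using finite_zeros_upto[of \<mu>] elim by (meson card_mono finite_Diff order_trans)
        also have "\<dots> < card (zeros_upto \<mu> (g \<mu>))"
          using finite_zeros_upto[of \<mu>] elim g[of \<mu>]
          by (intro card_Diff1_less) (auto simp: zeros_upto_def)
        finally show False using g[of \<mu>] elim by simp
      qed
    qed
  qed
  have eq: "nth_pos_zero (bessel_cross \<nu>) n = 2 * sqrt (g \<nu>)" if "\<nu> > -1" for \<nu>
    using nth_pos_zero_eq[OF nth[OF that]] .
  show ?thesis
  proof (intro conjI allI impI strict_mono_onI)
    show "is_nth_pos_zero (bessel_cross \<nu>) n (nth_pos_zero (bessel_cross \<nu>) n)" if "\<nu> > -1" for \<nu>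
      using nth[OF that] eq[OF that] by simp
    show "nth_pos_zero (bessel_cross \<nu>) n < nth_pos_zero (bessel_cross \<mu>) n"
      if "\<nu> \<in> {-1<..}" "\<mu> \<in> {-1<..}" "\<nu> < \<mu>" for \<nu> \<mu>
      using strict_mono_onD[OF mono that] that by (simp add: eq)
  qed
qed

end
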